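(* Let $h(x)\in\mathbb{F}_q(x)$ be a rational function such that the extension $\mathbb{F}_q(x)/\mathbb{F}_q(t)$ is Galois, where $t=h(x)$, and let $G_h$ be its Galois group. Consider the natural action of $G_h$ on the set of rational places of $\mathbb{F}_q(x)$. Then: (i) There are at most three short orbits. (ii) The total number of orbits is $\left\lceil\frac{q+1}{\deg(h)}\right\rceil$ when there are $0$ or $1$ short orbits, and $\left\lceil\frac{q+1}{\deg(h)}\right\rceil+1$ when there are $2$ or $3$ short orbits.
   Context: $q$ is a prime power. For $h=f/g$ with $f,g\in\mathbb{F}_q[x]$ coprime, $\deg(h)=\max\{\deg f,\deg g\}=[\mathbb{F}_q(x):\mathbb{F}_q(t)]$. The rational (degree-one) places of $\mathbb{F}_q(x)$ are the $q+1$ places corresponding to the points of $\mathbb{P}^1(\mathbb{F}_q)=\mathbb{F}_q\cup\{\infty\}$. An orbit of $G_h$ on the set of rational places is long if its size is $\#G_h=\deg(h)$, and short otherwise. *)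

theory Defs
  imports
    "HOL-Computational_Algebra.Polynomial"
    "HOL-Computational_Algebra.Fraction_Field"
    "HOL-Algebra.Group_Action"
    "HOL-Library.Cardinality"
begin

text \<open>
  A type \<open>'a\<close> of class \<open>{field, finite}\<close> plays the role of the finite field \<open>F_q\<close>, with
  \<open>q = CARD('a)\<close>; the rational function field \<open>F_q(x)\<close> is the type \<open>'a poly fract\<close>.
\<close>

type_synonym 'a ratfun = "'a poly fract"

definition rf_const :: "'a::field \<Rightarrow> 'a ratfun"
  where "rf_const c = Fract [:c:] 1"


subsection \<open>The degree of a rational function\<close>

definition is_reduced :: "'a::field ratfun \<Rightarrow> 'a poly \<Rightarrow> 'a poly \<Rightarrow> bool"
  where "is_reduced h f g \<longleftrightarrow> g \<noteq> 0 \<and> coprime f g \<and> h = Fract f g"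

definition rf_degree :: "'a::field ratfun \<Rightarrow> nat"
  where "rf_degree h = (THE n. \<exists>f g. is_reduced h f g \<and> n = max (degree f) (degree g))"

lemma coprime_poly_bezout:
  fixes f g :: "'a::field poly"
  assumes "coprime f g"
  shows "\<exists>a b. a * f + b * g = 1"
proof -
  define I where "I = {a * f + b * g | a b. True}"
  have If: "f \<in> I" unfolding I_def by (rule CollectI, rule exI[of _ 1], rule exI[of _ 0]) simp
  have Ig: "g \<in> I" unfolding I_def by (rule CollectI, rule exI[of _ 0], rule exI[of _ 1]) simp
  have "f \<noteq> 0 \<or> g \<noteq> 0" using assms by auto
  then have "\<exists>d. d \<in> I \<and> d \<noteq> 0" using If Ig by blast
  then obtain d where d: "d \<in> I" "d \<noteq> 0"
    and dmin: "\<And>e. e \<in> I \<Longrightarrow> e \<noteq> 0 \<Longrightarrow> degree d \<le> degree e"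
    using ex_has_least_nat[of "\<lambda>d. d \<in> I \<and> d \<noteq> 0" _ degree] by blast
  obtain a b where ab: "d = a * f + b * g" using d(1) unfolding I_def by blast
  have dvd: "d dvd y" if y: "y \<in> I" for y
  proof -
    obtain u v where uv: "y = u * f + v * g" using y unfolding I_def by blast
    have "y mod d = y - (y div d) * d" by (simp add: minus_div_mult_eq_mod)
    also have "\<dots> = (u - (y div d) * a) * f + (v - (y div d) * b) * g"
      unfolding ab[symmetric] using uv ab by (simp add: algebra_simps)
    finally have "y mod d \<in> I" unfolding I_def by blast
    then have "y mod d = 0"
      using dmin[of "y mod d"] degree_mod_less[OF d(2), of y] by force
    then show ?thesis by (simp add: mod_eq_0_iff_dvd)
  qed
  have "is_unit d" using assms dvd[OF If] dvd[OF Ig] by (rule coprime_common_divisor)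
  then obtain c where "1 = d * c" by (rule dvdE)
  then have "(c * a) * f + (c * b) * g = 1" unfolding ab by (simp add: algebra_simps)
  then show ?thesis by blast
qed

lemma coprime_poly_dvd_mult:
  fixes f g k :: "'a::field poly"
  assumes "coprime f g" "g dvd f * k"
  shows "g dvd k"
proof -
  obtain a b where "a * f + b * g = 1" using coprime_poly_bezout[OF assms(1)] by blast
  then have "k = a * (f * k) + g * (b * k)"
    by (metis (no_types, lifting) distrib_right mult.assoc mult.commute mult_1)
  then show ?thesis using assms(2) by (metis dvd_add dvd_mult dvd_triv_left)
qed

lemma rf_degree_eq:
  assumes "is_reduced h f g"
  shows "rf_degree h = max (degree f) (degree g)"
  unfolding rf_degree_def
proof (rule the_equality)
  show "\<exists>f' g'. is_reduced h f' g' \<and> max (degree f) (degree g) = max (degree f') (degree g')"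
    using assms by blast
next
  fix n assume "\<exists>f' g'. is_reduced h f' g' \<and> n = max (degree f') (degree g')"
  then obtain f' g' where r: "is_reduced h f' g'" and n: "n = max (degree f') (degree g')"
    by blast
  have nz: "g \<noteq> 0" "g' \<noteq> 0" and cp: "coprime f g" "coprime f' g'"
    and eq: "f * g' = f' * g"
    using assms r by (auto simp: is_reduced_def eq_fract)
  have "g dvd g'" using coprime_poly_dvd_mult[OF cp(1)] eq by (metis dvd_triv_right)
  moreover have "g' dvd g" using coprime_poly_dvd_mult[OF cp(2)] eq by (metis dvd_triv_right)
  ultimately have dg: "degree g = degree g'" using nz by (simp add: dvd_imp_degree_le le_antisym)
  have "degree f = degree f'"
  proof (cases "f = 0")
    case True
    then show ?thesis using eq nz by simp
  next
    case False
    then have "f' \<noteq> 0" using eq nz by auto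
    then show ?thesis using False eq nz dg by (metis add_right_cancel degree_mult_eq)
  qed
  then show "n = max (degree f) (degree g)" using n dg by simp
qed

lemma ex_is_reduced: "\<exists>f g. is_reduced h f g"
proof -
  obtain f0 g0 where "h = Fract f0 g0" "g0 \<noteq> 0" by (cases h) auto
  then have "\<exists>g f. g \<noteq> 0 \<and> h = Fract f g" by blast
  then obtain g f where g: "g \<noteq> 0" "h = Fract f g"
    and gmin: "\<And>f' g'. g' \<noteq> 0 \<Longrightarrow> h = Fract f' g' \<Longrightarrow> degree g \<le> degree g'"
    using ex_has_least_nat[of "\<lambda>g. \<exists>f. g \<noteq> 0 \<and> h = Fract f g" _ degree] by blast
  have "coprime f g"
  proof (rule coprimeI)
    fix d assume "d dvd f" "d dvd g"
    then obtain u v where u: "f = d * u" and v: "g = d * v" by (auto elim!: dvdE)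
    have nz: "d \<noteq> 0" "v \<noteq> 0" using g(1) v by auto
    have "h = Fract u v" using g nz u v by (simp add: eq_fract)
    then have "degree g \<le> degree v" using gmin nz by blast
    then have "degree d = 0" using v nz by (simp add: degree_mult_eq)
    then show "is_unit d" using nz is_unit_iff_degree by blast
  qed
  then show ?thesis using g unfolding is_reduced_def by blast
qed


subsection \<open>The extension generated by h, and its Galois group\<close>

definition is_subfield :: "'b::field set \<Rightarrow> bool"
  where "is_subfield K \<longleftrightarrow> 0 \<in> K \<and> 1 \<in> K \<and>
    (\<forall>a\<in>K. \<forall>b\<in>K. a - b \<in> K \<and> a * b \<in> K) \<and> (\<forall>a\<in>K. inverse a \<in> K)"

text \<open>\<open>F_q(h)\<close>, the subfield of \<open>F_q(x)\<close> generated by the constants and \<open>h\<close>.\<close>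

definition adjoin :: "'a::field ratfun \<Rightarrow> 'a ratfun set"
  where "adjoin h = \<Inter>{K. is_subfield K \<and> range rf_const \<subseteq> K \<and> h \<in> K}"

definition field_auto :: "('b::field \<Rightarrow> 'b) \<Rightarrow> bool"
  where "field_auto \<sigma> \<longleftrightarrow> bij \<sigma> \<and>
    (\<forall>a b. \<sigma> (a + b) = \<sigma> a + \<sigma> b) \<and> (\<forall>a b. \<sigma> (a * b) = \<sigma> a * \<sigma> b)"

definition field_auts_over :: "'b::field set \<Rightarrow> ('b \<Rightarrow> 'b) set"
  where "field_auts_over K = {\<sigma>. field_auto \<sigma> \<and> (\<forall>k\<in>K. \<sigma> k = k)}"

definition algebraic_over :: "'b::field set \<Rightarrow> 'b \<Rightarrow> bool"
  where "algebraic_over K y \<longleftrightarrow> (\<exists>p. p \<noteq> 0 \<and> (\<forall>i. coeff p i \<in> K) \<and> poly p y = 0)"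

text \<open>
  The extension of \<open>K\<close> by the ambient field is Galois: it is algebraic, and \<open>K\<close> is the fixed
  field of its automorphism group.
\<close>

definition galois_over :: "'b::field set \<Rightarrow> bool"
  where "galois_over K \<longleftrightarrow> is_subfield K \<and> (\<forall>y. algebraic_over K y) \<and>
    {y. \<forall>\<sigma>\<in>field_auts_over K. \<sigma> y = y} = K"

definition galois_group :: "'a::field ratfun \<Rightarrow> ('a ratfun \<Rightarrow> 'a ratfun) monoid"
  where "galois_group h =
    \<lparr>carrier = field_auts_over (adjoin h), mult = (\<circ>), one = id\<rparr>"


subsection \<open>Rational places and the natural action\<close>

definition valuation_ring :: "'a::field ratfun set \<Rightarrow> bool"
  where "valuation_ring V \<longleftrightarrow> range rf_const \<subset> V \<and> V \<subset> UNIV \<and>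
    (\<forall>a\<in>V. \<forall>b\<in>V. a - b \<in> V \<and> a * b \<in> V) \<and> (\<forall>z. z \<in> V \<or> inverse z \<in> V)"

text \<open>The maximal ideal of a valuation ring consists of its non-units.\<close>

definition nonunits :: "'a::field ratfun set \<Rightarrow> 'a ratfun set"
  where "nonunits V = {z \<in> V. \<not> (\<exists>w\<in>V. z * w = 1)}"

text \<open>
  A place is the maximal ideal of a valuation ring \<open>V\<close>.  It has degree one when the residue
  field is \<open>F_q\<close>, i.e. when the canonical (injective) map from the constants to \<open>V / P\<close> is onto.
\<close>

definition rational_places :: "'a::field ratfun set set"
  where "rational_places =
    {nonunits V | V. valuation_ring V \<and> (\<forall>z\<in>V. \<exists>c. z - rf_const c \<in> nonunits V)}"

text \<open>
  An automorphism \<open>\<sigma>\<close> maps the place \<open>P\<close> to \<open>\<sigma>(P)\<close>.  The restriction to rational places makes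
  the map extensional, as required by \<^const>\<open>BijGroup\<close> and hence by \<^locale>\<open>group_action\<close>.
\<close>

definition place_action ::
    "('a::field ratfun \<Rightarrow> 'a ratfun) \<Rightarrow> 'a ratfun set \<Rightarrow> 'a ratfun set"
  where "place_action \<sigma> = (\<lambda>P \<in> rational_places. \<sigma> ` P)"

definition place_orbits :: "'a::field ratfun \<Rightarrow> 'a ratfun set set set"
  where "place_orbits h = orbits (galois_group h) rational_places place_action"

definition short_orbits :: "'a::field ratfun \<Rightarrow> 'a ratfun set set set"
  where "short_orbits h = {B \<in> place_orbits h. card B \<noteq> order (galois_group h)}"


subsection \<open>The Galois group acts on the rational places\<close>

lemma field_auto_simps:
  assumes "field_auto \<sigma>"
  shows "\<sigma> (a + b) = \<sigma> a + \<sigma> b" "\<sigma> (a * b) = \<sigma> a * \<sigma> b" "\<sigma> (a - b) = \<sigma> a - \<sigma> b"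
    "\<sigma> 0 = 0" "\<sigma> 1 = 1" "\<sigma> (inverse a) = inverse (\<sigma> a)" "\<sigma> a = \<sigma> b \<longleftrightarrow> a = b"
proof -
  have add: "\<And>a b. \<sigma> (a + b) = \<sigma> a + \<sigma> b" and mult: "\<And>a b. \<sigma> (a * b) = \<sigma> a * \<sigma> b"
    and bij: "bij \<sigma>" using assms by (auto simp: field_auto_def)
  show inj: "\<sigma> a = \<sigma> b \<longleftrightarrow> a = b" for a b using bij by (metis bij_pointE)
  show "\<sigma> (a + b) = \<sigma> a + \<sigma> b" "\<sigma> (a * b) = \<sigma> a * \<sigma> b" using add mult by auto
  show "\<sigma> (a - b) = \<sigma> a - \<sigma> b" using add[of "a - b" b] by (simp add: eq_diff_eq)
  show z: "\<sigma> 0 = 0" using add[of 0 0] by (metis add_cancel_right_right add_0)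
  have nz: "\<sigma> y \<noteq> 0" if "y \<noteq> 0" for y using that inj z by metis
  show o: "\<sigma> 1 = 1" using mult[of 1 1] nz[of 1] by simp
  show "\<sigma> (inverse a) = inverse (\<sigma> a)"
  proof (cases "a = 0")
    case False
    then have "\<sigma> a * \<sigma> (inverse a) = 1" using mult[of a "inverse a"] o by simp
    then show ?thesis by (rule inverse_unique[symmetric])
  qed (simp add: z)
qed

lemma group_galois_group: "group (galois_group h)"
proof (rule groupI)
  show "x \<otimes>\<^bsub>galois_group h\<^esub> y \<in> carrier (galois_group h)"
    if "x \<in> carrier (galois_group h)" "y \<in> carrier (galois_group h)" for x y
    using that by (auto simp: galois_group_def field_auts_over_def field_auto_def bij_comp)
next
  fix \<sigma> assume "\<sigma> \<in> carrier (galois_group h)"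
  then have s: "field_auto \<sigma>" "\<And>k. k \<in> adjoin h \<Longrightarrow> \<sigma> k = k"
    by (auto simp: galois_group_def field_auts_over_def)
  have b: "bij \<sigma>" using s(1) by (simp add: field_auto_def)
  have inv: "\<sigma> (inv_into UNIV \<sigma> y) = y" for y
    using b by (simp add: bij_is_surj surj_f_inv_f)
  have "field_auto (inv_into UNIV \<sigma>)"
    unfolding field_auto_def
  proof (intro conjI allI)
    show "bij (inv_into UNIV \<sigma>)" using b by (rule bij_imp_bij_inv)
  next
    fix a b
    show "inv_into UNIV \<sigma> (a + b) = inv_into UNIV \<sigma> a + inv_into UNIV \<sigma> b"
      using field_auto_simps(1,7)[OF s(1)] inv by metis
    show "inv_into UNIV \<sigma> (a * b) = inv_into UNIV \<sigma> a * inv_into UNIV \<sigma> b"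
      using field_auto_simps(2,7)[OF s(1)] inv by metis
  qed
  moreover have "inv_into UNIV \<sigma> k = k" if "k \<in> adjoin h" for k
    using s(2)[OF that] inv field_auto_simps(7)[OF s(1)] by metis
  ultimately show "\<exists>\<tau>\<in>carrier (galois_group h). \<tau> \<otimes>\<^bsub>galois_group h\<^esub> \<sigma> = \<one>\<^bsub>galois_group h\<^esub>"
    using b by (auto simp: galois_group_def field_auts_over_def bij_is_inj
        intro!: bexI[of _ "inv_into UNIV \<sigma>"])
qed (auto simp: galois_group_def field_auts_over_def field_auto_def o_assoc)

lemma galois_group_image_rational_place:
  assumes \<sigma>: "\<sigma> \<in> carrier (galois_group h)" and P: "P \<in> rational_places"
  shows "\<sigma> ` P \<in> rational_places"
proof -
  have s: "field_auto \<sigma>" "\<And>k. k \<in> adjoin h \<Longrightarrow> \<sigma> k = k"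
    using \<sigma> by (auto simp: galois_group_def field_auts_over_def)
  note S = field_auto_simps[OF s(1)]
  have b: "bij \<sigma>" using s(1) by (simp add: field_auto_def)
  have c: "\<sigma> (rf_const k) = rf_const k" for k
    by (rule s(2)) (auto simp: adjoin_def)
  have mem: "\<sigma> y \<in> \<sigma> ` A \<longleftrightarrow> y \<in> A" for y A
    using inj_image_mem_iff[OF bij_is_inj[OF b]] by blast
  have surj: "\<exists>y. z = \<sigma> y" for z using b by (meson bij_pointE)
  obtain V where V: "valuation_ring V" "P = nonunits V"
    "\<And>z. z \<in> V \<Longrightarrow> \<exists>c. z - rf_const c \<in> nonunits V"
    using P unfolding rational_places_def by blast
  have nu: "nonunits (\<sigma> ` V) = \<sigma> ` nonunits V"
  proof -
    have "(\<sigma> z * \<sigma> w = 1) \<longleftrightarrow> (z * w = 1)" for z w using S(2,5,7) by metis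
    then show ?thesis unfolding nonunits_def by auto
  qed
  have "range rf_const \<subset> \<sigma> ` V"
  proof -
    have "range rf_const = \<sigma> ` range rf_const" using c by (simp add: image_image)
    moreover have "range rf_const \<subset> V" using V(1) by (simp add: valuation_ring_def)
    ultimately show ?thesis using b by (metis bij_is_inj inj_image_eq_iff image_mono psubset_eq)
  qed
  moreover have "\<sigma> ` V \<subset> UNIV"
    using V(1) mem unfolding valuation_ring_def by (metis UNIV_I psubset_eq subset_UNIV UNIV_eq_I)
  moreover have "\<forall>a\<in>\<sigma> ` V. \<forall>b\<in>\<sigma> ` V. a - b \<in> \<sigma> ` V \<and> a * b \<in> \<sigma> ` V"
    using V(1) unfolding valuation_ring_def by (auto simp: S(2,3)[symmetric])
  moreover have "z \<in> \<sigma> ` V \<or> inverse z \<in> \<sigma> ` V" for z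
  proof -
    obtain y where "z = \<sigma> y" using surj by blast
    then show ?thesis using V(1) S(6) mem unfolding valuation_ring_def by metis
  qed
  ultimately have "valuation_ring (\<sigma> ` V)" unfolding valuation_ring_def by blast
  moreover have "\<exists>c. z - rf_const c \<in> nonunits (\<sigma> ` V)" if z: "z \<in> \<sigma> ` V" for z
  proof -
    obtain y where y: "z = \<sigma> y" "y \<in> V" using z by blast
    then obtain k where "y - rf_const k \<in> nonunits V" using V(3) by blast
    then have "\<sigma> (y - rf_const k) \<in> \<sigma> ` nonunits V" by blast
    then show ?thesis using nu y(1) S(3) c by metis
  qed
  ultimately have "nonunits (\<sigma> ` V) \<in> rational_places" unfolding rational_places_def by blast
  then show ?thesis using nu V(2) by simp
qed

lemma group_action_places:
  "group_action (galois_group h) rational_places place_action"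
proof -
  let ?G = "galois_group h"
  interpret G: group ?G by (rule group_galois_group)
  have Bij: "place_action \<sigma> \<in> Bij rational_places" if \<sigma>: "\<sigma> \<in> carrier ?G" for \<sigma>
  proof -
    obtain \<tau> where \<tau>: "\<tau> \<in> carrier ?G" "\<sigma> \<circ> \<tau> = id" "\<tau> \<circ> \<sigma> = id"
      using G.l_inv_ex[OF \<sigma>] G.r_inv_ex[OF \<sigma>] G.inv_closed[OF \<sigma>] G.l_inv[OF \<sigma>] G.r_inv[OF \<sigma>]
      by (simp add: galois_group_def)
    have st: "\<sigma> ` \<tau> ` P = P" "\<tau> ` \<sigma> ` P = P" for P
      using \<tau>(2,3) by (simp_all add: image_comp)
    have "bij_betw (\<lambda>P. \<sigma> ` P) rational_places rational_places"
      by (rule bij_betwI[where g = "\<lambda>P. \<tau> ` P"])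
        (use st galois_group_image_rational_place \<sigma> \<tau>(1) in auto)
    then show ?thesis by (simp add: Bij_def place_action_def)
  qed
  have "place_action (\<sigma> \<circ> \<tau>) = compose rational_places (place_action \<sigma>) (place_action \<tau>)"
    if "\<tau> \<in> carrier ?G" for \<sigma> \<tau> :: "'a ratfun \<Rightarrow> 'a ratfun"
    using galois_group_image_rational_place[OF that]
    by (auto simp: place_action_def compose_def fun_eq_iff restrict_def image_comp)
  then have "place_action \<in> hom ?G (BijGroup rational_places)"
    using Bij by (auto simp: hom_def BijGroup_def galois_group_def)
  then show ?thesis
    unfolding group_action_def group_hom_def group_hom_axioms_def
    using group_galois_group group_BijGroup by blast
qed

end

theory Submission
  imports Defs "HOL-Computational_Algebra.Polynomial_Factorial"
begin

text \<open>
  An automorphism of \<open>F_q(x)\<close> over \<open>F_q\<close> sends \<open>x\<close> to a rational function of degree one, so unless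
  it is the identity it fixes at most two of the \<open>q + 1\<close> rational places: the fixed points of
  \<open>x \<mapsto> f / g\<close> satisfy a polynomial equation of degree at most two.  Since the Galois group has order
  \<open>deg h\<close>, Burnside's lemma then bounds the total size of the short orbits from below, which is
  all that is needed.  In particular the Hurwitz genus formula, and with it any distinction
  between tame and wild ramification, can be avoided.
\<close>

subsection \<open>Evaluation of polynomials and simple extensions of the constants\<close>

text \<open>The Galois hypothesis says only that the extension is algebraic with fixed field F_q(h);
  no degree and no group order comes with it. The decisive estimate is
  \<open>degree_ge_rf_degree\<close>: a nonzero polynomial over F_q(h) that vanishes at x has degree
  at least deg h. Applied to the product of all X - \<sigma> x, it bounds the group order from
  below; applied with \<sigma> x in place of h, it shows that \<sigma> x has degree at most one.
  Places, in turn, are ideals of abstract valuation rings, so fixed places can be read off as roots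
  only after every rational place is matched with a point of the projective line.\<close>

lemma map_poly_add_hom:
  assumes "\<phi> 0 = 0" "\<And>x y. \<phi> (x + y) = \<phi> x + \<phi> y"
  shows "map_poly \<phi> (p + q) = map_poly \<phi> p + map_poly \<phi> q"
  using assms by (intro poly_eqI) (simp add: coeff_map_poly)

lemma map_poly_mult_hom:
  fixes \<phi> :: "'a::comm_semiring_0 \<Rightarrow> 'b::comm_semiring_0"
  assumes "\<phi> 0 = 0" "\<And>x y. \<phi> (x + y) = \<phi> x + \<phi> y" "\<And>x y. \<phi> (x * y) = \<phi> x * \<phi> y"
  shows "map_poly \<phi> (p * q) = map_poly \<phi> p * map_poly \<phi> q"
proof (induction p)
  case (pCons a p)
  have "map_poly \<phi> (smult a q) = smult (\<phi> a) (map_poly \<phi> q)"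
    using assms by (simp add: map_poly_smult)
  then show ?case
    using pCons by (simp add: map_poly_add_hom assms map_poly_pCons)
qed simp

lemma map_poly_prod_hom:
  fixes \<phi> :: "'a::comm_semiring_1 \<Rightarrow> 'b::comm_semiring_1"
  assumes "\<phi> 0 = 0" "\<phi> 1 = 1" "\<And>x y. \<phi> (x + y) = \<phi> x + \<phi> y" "\<And>x y. \<phi> (x * y) = \<phi> x * \<phi> y"
  shows "map_poly \<phi> (\<Prod>i\<in>A. f i) = (\<Prod>i\<in>A. map_poly \<phi> (f i))"
  using assms by (induction A rule: infinite_finite_induct) (simp_all add: map_poly_mult_hom)

lemma rf_const_eq_to_fract: "rf_const c = to_fract [:c:]"
  by (simp add: rf_const_def to_fract_def)

lemma rf_const_hom [simp]:
  "rf_const 0 = 0" "rf_const 1 = 1"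
  "rf_const (a + b) = rf_const a + rf_const b" "rf_const (a * b) = rf_const a * rf_const b"
  "rf_const (a - b) = rf_const a - rf_const b" "rf_const (- a) = - rf_const a"
  "rf_const (inverse a) = inverse (rf_const a)"
  "rf_const a = rf_const b \<longleftrightarrow> a = b" "rf_const a = 0 \<longleftrightarrow> a = 0"
proof -
  show "rf_const 0 = 0" "rf_const 1 = 1"
    by (simp_all add: rf_const_eq_to_fract one_pCons[symmetric])
  show m: "rf_const (a * b) = rf_const a * rf_const b" for a b
    unfolding rf_const_eq_to_fract to_fract_mult[symmetric] by simp
  show "rf_const (a + b) = rf_const a + rf_const b" 
  "rf_const (a - b) = rf_const a - rf_const b" "rf_const (- a) = - rf_const a"
    unfolding rf_const_eq_to_fract to_fract_add[symmetric] to_fract_diff[symmetric]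
      to_fract_uminus[symmetric] by simp_all
  show "rf_const a = rf_const b \<longleftrightarrow> a = b" "rf_const a = 0 \<longleftrightarrow> a = 0"
    by (simp_all add: rf_const_eq_to_fract)
  show "rf_const (inverse a) = inverse (rf_const a)"
  proof (cases "a = 0")
    case False
    then have "rf_const a * rf_const (inverse a) = 1"
      unfolding m[symmetric] by (simp add: \<open>rf_const 1 = 1\<close>)
    then show ?thesis by (rule inverse_unique[symmetric])
  qed (simp add: \<open>rf_const 0 = 0\<close>)
qed

section \<open>Substitution of rational functions into polynomials\<close>

definition rf_X :: "'a::field ratfun"
  where "rf_X = to_fract [:0, 1:]"

definition rf_eval :: "'a::field poly \<Rightarrow> 'a ratfun \<Rightarrow> 'a ratfun"
  where "rf_eval p z = poly (map_poly rf_const p) z"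

lemma rf_eval_simps [simp]:
  "rf_eval 0 z = 0" "rf_eval 1 z = 1" "rf_eval (p + q) z = rf_eval p z + rf_eval q z"
  "rf_eval (p * q) z = rf_eval p z * rf_eval q z" "rf_eval (p - q) z = rf_eval p z - rf_eval q z"
  "rf_eval (pCons c p) z = rf_const c + z * rf_eval p z"
proof -
  show add: "rf_eval (p + q) z = rf_eval p z + rf_eval q z" for p q
    by (simp add: rf_eval_def map_poly_add_hom)
  show "rf_eval (p - q) z = rf_eval p z - rf_eval q z"
    using add[of "p - q" q] by simp
qed (simp_all add: rf_eval_def map_poly_mult_hom map_poly_pCons)

lemma rf_eval_X: "rf_eval p rf_X = to_fract p"
proof (induction p)
  case (pCons a p)
  have "to_fract (pCons a p) = to_fract ([:a:] + [:0, 1:] * p)" by simp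
  also have "\<dots> = rf_const a + rf_X * to_fract p"
    unfolding to_fract_add to_fract_mult by (simp add: rf_const_eq_to_fract rf_X_def)
  finally show ?case using pCons by simp
qed simp

lemma rf_eval_hom:
  assumes "field_auto \<sigma>" "\<And>c. \<sigma> (rf_const c) = rf_const c"
  shows "rf_eval p (\<sigma> z) = \<sigma> (rf_eval p z)"
  by (induction p) (simp_all add: field_auto_simps[OF assms(1)] assms(2))

section \<open>Subfields and the elements of F_q(h)\<close>

lemma is_subfieldD:
  assumes "is_subfield K"
  shows "0 \<in> K" "1 \<in> K" "\<And>a b. a \<in> K \<Longrightarrow> b \<in> K \<Longrightarrow> a - b \<in> K"
    "\<And>a b. a \<in> K \<Longrightarrow> b \<in> K \<Longrightarrow> a + b \<in> K" "\<And>a b. a \<in> K \<Longrightarrow> b \<in> K \<Longrightarrow> a * b \<in> K"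
    "\<And>a. a \<in> K \<Longrightarrow> inverse a \<in> K" "\<And>a b. a \<in> K \<Longrightarrow> b \<in> K \<Longrightarrow> a / b \<in> K"
proof -
  show z: "0 \<in> K" "1 \<in> K" and s: "\<And>a b. a \<in> K \<Longrightarrow> b \<in> K \<Longrightarrow> a - b \<in> K"
    and m: "\<And>a b. a \<in> K \<Longrightarrow> b \<in> K \<Longrightarrow> a * b \<in> K" and i: "\<And>a. a \<in> K \<Longrightarrow> inverse a \<in> K"
    using assms by (auto simp: is_subfield_def)
  show "a + b \<in> K" if "a \<in> K" "b \<in> K" for a b
    using s[OF that(1) s[OF z(1) that(2)]] by simp
  show "a / b \<in> K" if "a \<in> K" "b \<in> K" for a b
    using m[OF that(1) i[OF that(2)]] by (simp add: divide_inverse)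
qed

text \<open>Reduces a claim about all of F_q(x) to the constants and x, once the elements satisfying
  it are known to form a subfield.\<close>

lemma subfield_with_rf_X:
  assumes K: "is_subfield K" "range rf_const \<subseteq> K" "rf_X \<in> K"
  shows "K = UNIV"
proof -
  note D = is_subfieldD[OF K(1)]
  have "rf_eval p rf_X \<in> K" for p
    using K(2,3) by (induction p) (auto intro!: D)
  then have "Fract f g \<in> K" for f g
    by (simp add: Fract_conv_to_fract rf_eval_X D(7))
  then have "z \<in> K" for z by (cases z) auto
  then show ?thesis by blast
qed

lemma adjoin_least: "is_subfield K \<Longrightarrow> range rf_const \<subseteq> K \<Longrightarrow> h \<in> K \<Longrightarrow> adjoin h \<subseteq> K"
  by (auto simp: adjoin_def)

lemma adjoin_const: "rf_const c \<in> adjoin h" and adjoin_self: "h \<in> adjoin h"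
  by (auto simp: adjoin_def)

text \<open>The quotients of polynomial values at \<open>h\<close> already form a subfield
  containing the constants and \<open>h\<close>, so the intersection defining
  \<open>adjoin h\<close> lies inside them.\<close>

lemma adjoinE:
  assumes "z \<in> adjoin h"
  obtains a b where "rf_eval b h \<noteq> 0" "z = rf_eval a h / rf_eval b h"
proof -
  let ?K = "{z. \<exists>a b. rf_eval b h \<noteq> 0 \<and> z = rf_eval a h / rf_eval b h}"
  have mem: "rf_eval a h / rf_eval b h \<in> ?K" if "rf_eval b h \<noteq> 0" for a b
    using that by blast
  have p: "rf_eval a h \<in> ?K" for a using mem[of 1 a] by simp
  have "is_subfield ?K"
    unfolding is_subfield_def
  proof (intro conjI ballI)
    show "0 \<in> ?K" "1 \<in> ?K" using p[of 0] p[of 1] by (simp_all only: rf_eval_simps)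
  next
    fix u v assume "u \<in> ?K" "v \<in> ?K"
    then obtain a b c d where *: "rf_eval b h \<noteq> 0" "u = rf_eval a h / rf_eval b h"
      "rf_eval d h \<noteq> 0" "v = rf_eval c h / rf_eval d h" by auto
    then have "u - v = rf_eval (a * d - c * b) h / rf_eval (b * d) h"
      "u * v = rf_eval (a * c) h / rf_eval (b * d) h" by (simp_all add: diff_frac_eq)
    moreover have "rf_eval (b * d) h \<noteq> 0" using * by simp
    ultimately show "u - v \<in> ?K" "u * v \<in> ?K" using mem by presburger+
  next
    fix u assume "u \<in> ?K"
    then obtain a b where *: "rf_eval b h \<noteq> 0" "u = rf_eval a h / rf_eval b h" by auto
    show "inverse u \<in> ?K"
    \<comment> \<open>Since \<open>inverse 0 = 0\<close>, a vanishing numerator is treated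
      apart.\<close>
    proof (cases "rf_eval a h = 0")
      case True then show ?thesis using * p[of 0] by simp
    next
      case False then show ?thesis using * mem[of a b] by simp
    qed
  qed
  moreover have "range rf_const \<subseteq> ?K" using p[of "[:c:]" for c] by auto
  moreover have "h \<in> ?K" using p[of "[:0, 1:]"] by simp
  ultimately have "adjoin h \<subseteq> ?K" by (rule adjoin_least)
  then show ?thesis using assms that by blast
qed

text \<open>Lets the coefficients of a polynomial over F_q(h) be scaled into F_q[h] all at
  once.\<close>

lemma common_denominator:
  assumes "finite A" "A \<subseteq> adjoin h"
  shows "\<exists>b. rf_eval b h \<noteq> 0 \<and> (\<forall>z\<in>A. \<exists>a. z * rf_eval b h = rf_eval a h)"
  using assms
proof (induction A rule: finite_induct)
  case empty
  show ?case by (rule exI[of _ 1]) simp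
next
  case (insert z A)
  then obtain b where b: "rf_eval b h \<noteq> 0" "\<forall>z\<in>A. \<exists>a. z * rf_eval b h = rf_eval a h"
    by auto
  obtain c d where cd: "rf_eval d h \<noteq> 0" "z = rf_eval c h / rf_eval d h"
    using insert.prems by (auto elim: adjoinE)
  show ?case
  proof (rule exI[of _ "b * d"], intro conjI ballI)
    show "rf_eval (b * d) h \<noteq> 0" using b cd by simp
    fix y assume "y \<in> insert z A"
    then consider "y = z" | a where "y * rf_eval b h = rf_eval a h" using b by blast
    then show "\<exists>a. y * rf_eval (b * d) h = rf_eval a h"
    proof cases
      case 1
      then have "y * rf_eval (b * d) h = rf_eval (c * b) h" using cd by simp
      then show ?thesis by blast
    next
      case (2 a)
      then have "y * rf_eval (b * d) h = rf_eval (a * d) h" by (simp add: mult.assoc[symmetric])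
      then show ?thesis by blast
    qed
  qed
qed

text \<open>
  Modulo \<open>u\<close> only the term \<open>b 0 * v ^ D\<close> survives, so \<open>u\<close> divides \<open>b 0\<close>, which has smaller degree.
\<close>

lemma homogeneous_form_eq_0:
  fixes u v :: "'a::field poly"
  assumes "coprime u v" "\<And>j. degree (b j) < degree u"
    and "(\<Sum>j\<le>D. b j * u ^ j * v ^ (D - j)) = 0" and "j \<le> D"
  shows "b j = 0"
  using assms(2-)
proof (induction D arbitrary: b j)
  case (Suc D)
  have cancel: "u dvd w" if "u dvd v ^ n * w" for n w
    using that
  proof (induction n)
    case (Suc n)
    then have "u dvd v * (v ^ n * w)" by (simp add: mult.assoc)
    then show ?case
      using Suc.IH coprime_poly_dvd_mult assms(1) by (metis coprime_commute)
  qed simp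
  have u: "u \<noteq> 0" using Suc.prems(1)[of 0] by auto
  have 1: "(\<Sum>j\<le>Suc D. b j * u ^ j * v ^ (Suc D - j)) =
      b 0 * v ^ Suc D + u * (\<Sum>j\<le>D. b (Suc j) * u ^ j * v ^ (D - j))"
    unfolding sum.atMost_Suc_shift by (simp add: sum_distrib_left algebra_simps)
  have "b 0 * v ^ Suc D = u * (- (\<Sum>j\<le>D. b (Suc j) * u ^ j * v ^ (D - j)))"
    using Suc.prems(2) 1 by (simp add: add_eq_0_iff)
  then have "u dvd v ^ Suc D * b 0" by (metis dvd_triv_left mult.commute)
  then have "u dvd b 0" by (rule cancel)
  then have b0: "b 0 = 0" using Suc.prems(1)[of 0] by (meson dvd_imp_degree_le leD)
  then have "(\<Sum>j\<le>D. b (Suc j) * u ^ j * v ^ (D - j)) = 0"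
    using Suc.prems(2) 1 u by simp
  then have "b (Suc i) = 0" if "i \<le> D" for i
    using Suc.IH[of "\<lambda>i. b (Suc i)" i] Suc.prems(1) that by blast
  then show ?case using b0 Suc.prems(3) by (cases j) auto
qed auto

subsection \<open>The degree of the extension and the order of the Galois group\<close>

text \<open>Homogenization: the \<open>D\<close>-th power of \<open>g\<close> turns the value at f/g
  into a form of degree \<open>D\<close> in \<open>f\<close> and \<open>g\<close>, also when
  \<open>D\<close> exceeds the degree of \<open>a\<close>.\<close>

lemma rf_eval_times_power:
  assumes "degree a \<le> D" "g \<noteq> 0"
  shows "rf_eval a (Fract f g) * to_fract g ^ D =
    (\<Sum>j\<le>D. rf_const (coeff a j) * to_fract f ^ j * to_fract g ^ (D - j))"
proof -
  let ?h = "to_fract f / to_fract g"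
  have "rf_eval a ?h = (\<Sum>j\<le>D. rf_const (coeff a j) * ?h ^ j)"
    unfolding rf_eval_def poly_altdef using assms(1)
    by (intro sum.mono_neutral_cong_left)
      (auto simp: coeff_map_poly degree_map_poly coeff_eq_0)
  then have "rf_eval a ?h * to_fract g ^ D =
      (\<Sum>j\<le>D. rf_const (coeff a j) * ?h ^ j * to_fract g ^ D)"
    by (simp add: sum_distrib_right)
  also have "\<dots> = (\<Sum>j\<le>D. rf_const (coeff a j) * to_fract f ^ j * to_fract g ^ (D - j))"
  proof (intro sum.cong refl)
    fix j assume "j \<in> {..D}"
    then have "to_fract g ^ D = to_fract g ^ j * to_fract g ^ (D - j)"
      by (simp flip: power_add)
    then show "rf_const (coeff a j) * ?h ^ j * to_fract g ^ D =
        rf_const (coeff a j) * to_fract f ^ j * to_fract g ^ (D - j)"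
      using assms(2) by (simp add: power_divide)
  qed
  finally show ?thesis by (simp add: Fract_conv_to_fract)
qed

lemma to_fract_power: "to_fract (p ^ n) = to_fract p ^ n"
  by (induction n) simp_all

lemma rf_const_times_rf_X_power: "rf_const c * rf_X ^ i = to_fract (monom c i)"
  unfolding rf_const_eq_to_fract rf_X_def monom_altdef[of c i]
  by (simp flip: to_fract_power to_fract_mult)

text \<open>Once denominators are cleared, the relation at x is regrouped by powers of
  \<open>f\<close> and \<open>g\<close> instead of powers of x. Its coefficients \<open>B j\<close>
  are polynomials in x of degree at most \<open>degree p\<close>; were this below deg h,
  \<open>homogeneous_form_eq_0\<close> would make all of them vanish, and with them the leading
  coefficient of \<open>p\<close>.\<close>

lemma degree_ge_rf_degree:
  assumes coeffs: "\<And>i. coeff p i \<in> adjoin h" and root: "poly p rf_X = 0" and "p \<noteq> 0"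
  shows "rf_degree h \<le> degree p"
proof (rule ccontr)
  define m where "m = degree p"
  assume "\<not> rf_degree h \<le> degree p"
  then have less: "m < rf_degree h" by (simp add: m_def)
  obtain f g where fg: "is_reduced h f g" using ex_is_reduced by blast
  then have g: "g \<noteq> 0" "coprime f g" "h = Fract f g" by (auto simp: is_reduced_def)
  have "\<exists>b. rf_eval b h \<noteq> 0 \<and> (\<forall>z\<in>coeff p ` {..m}. \<exists>a. z * rf_eval b h = rf_eval a h)"
    using coeffs by (intro common_denominator) auto
  then obtain b where b: "rf_eval b h \<noteq> 0"
    and "\<forall>i\<in>{..m}. \<exists>a. coeff p i * rf_eval b h = rf_eval a h" by blast
  then obtain a where a: "\<And>i. i \<le> m \<Longrightarrow> coeff p i * rf_eval b h = rf_eval (a i) h"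
    by (metis atMost_iff)
  \<comment> \<open>A crude common bound for the degrees of all \<open>a i\<close>, so that one
    power of \<open>g\<close> clears every denominator.\<close>
  define D where "D = (\<Sum>i\<le>m. degree (a i))"
  have D: "degree (a i) \<le> D" if "i \<le> m" for i
    unfolding D_def using that by (intro member_le_sum) auto
  \<comment> \<open>The factor of the \<open>j\<close>-th power of \<open>h\<close>, gathered over
    all coefficients of \<open>p\<close> and read as a polynomial in x.\<close>
  define B where "B j = (\<Sum>i\<le>m. monom (coeff (a i) j) i)" for j
  have degB: "degree (B j) < rf_degree h" for j
  proof -
    have "degree (B j) \<le> m"
      unfolding B_def by (intro degree_sum_le) (auto intro: order.trans[OF degree_monom_le])
    then show ?thesis using less by simp
  qed
  have "0 = poly p rf_X * rf_eval b h * to_fract g ^ D" using root by simp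
  also have "\<dots> = (\<Sum>i\<le>m. rf_X ^ i * (coeff p i * rf_eval b h * to_fract g ^ D))"
    by (simp add: poly_altdef m_def sum_distrib_left sum_distrib_right mult_ac)
  also have "\<dots> = (\<Sum>i\<le>m. rf_X ^ i * (\<Sum>j\<le>D. rf_const (coeff (a i) j) *
      to_fract f ^ j * to_fract g ^ (D - j)))"
    using a D g(1) by (intro sum.cong refl) (simp add: g(3) rf_eval_times_power)
  also have "\<dots> = (\<Sum>i\<le>m. \<Sum>j\<le>D.
      to_fract (monom (coeff (a i) j) i * f ^ j * g ^ (D - j)))"
    by (simp add: sum_distrib_left to_fract_power mult_ac flip: rf_const_times_rf_X_power)
  also have "\<dots> = to_fract (\<Sum>j\<le>D. B j * f ^ j * g ^ (D - j))"
    unfolding B_def sum_distrib_right to_fract_sum by (rule sum.swap)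
  finally have form: "(\<Sum>j\<le>D. B j * f ^ j * g ^ (D - j)) = 0"
    by (metis to_fract_eq_0_iff)
  have B0: "B j = 0" if "j \<le> D" for j
  \<comment> \<open>The form lemma needs coefficients of degree below that of its first base. If
    \<open>g\<close> rather than \<open>f\<close> attains deg h, the two are exchanged by reversing
    the index.\<close>
  proof (cases "rf_degree h = degree f")
    case True
    then show ?thesis using homogeneous_form_eq_0[OF g(2) _ form that] degB by simp
  next
    case False
    then have dg: "rf_degree h = degree g" using rf_degree_eq[OF fg] by linarith
    have "(\<Sum>j\<le>D. B (D - j) * g ^ j * f ^ (D - j)) = (\<Sum>j\<le>D. B j * f ^ j * g ^ (D - j))"
      by (rule sum.reindex_bij_witness[of _ "\<lambda>j. D - j" "\<lambda>j. D - j"]) (auto simp: mult_ac)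
    then have "B (D - (D - j)) = 0"
      using homogeneous_form_eq_0[of g f "\<lambda>j. B (D - j)" D "D - j"] form g(2) degB dg
      by (simp add: coprime_commute)
    then show ?thesis using that by simp
  qed
  have "coeff p m = 0"
  proof -
    have "coeff (a m) j = 0" for j
    proof (cases "j \<le> D")
      case True
      have "coeff (a m) j = coeff (B j) m"
        by (simp add: B_def coeff_sum coeff_monom)
      then show ?thesis using B0[OF True] by simp
    next
      case False
      then show ?thesis using D[of m] by (simp add: coeff_eq_0)
    qed
    then have "a m = 0" by (simp add: poly_eq_iff)
    then show ?thesis using a[of m] b by simp
  qed
  then show False using \<open>p \<noteq> 0\<close> by (simp add: m_def)
qed

text \<open>As \<sigma> is onto, \<sigma> x generates F_q(x) again, so X - x is a polynomial of
  degree one over F_q(\<sigma> x) with root x.\<close>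

lemma rf_degree_field_auto_rf_X:
  assumes \<sigma>: "field_auto \<sigma>" "\<And>c. \<sigma> (rf_const c) = rf_const c"
  shows "rf_degree (\<sigma> rf_X) \<le> 1"
proof -
  have "K = UNIV" if K: "is_subfield K" "range rf_const \<subseteq> K" "\<sigma> rf_X \<in> K" for K
  proof -
    have "is_subfield (\<sigma> -` K)"
      using is_subfieldD[OF K(1)] by (simp add: is_subfield_def field_auto_simps[OF \<sigma>(1)])
    moreover have "range rf_const \<subseteq> \<sigma> -` K" using K(2) \<sigma>(2) by auto
    ultimately have "\<sigma> -` K = UNIV" using K(3) by (intro subfield_with_rf_X) auto
    moreover have "surj \<sigma>" using \<sigma>(1) by (simp add: field_auto_def bij_is_surj)
    ultimately show ?thesis by (metis surj_image_vimage_eq)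
  qed
  then have "adjoin (\<sigma> rf_X) = UNIV" by (auto simp: adjoin_def)
  then have "rf_degree (\<sigma> rf_X) \<le> degree [:- rf_X, 1::'a ratfun:]"
    by (intro degree_ge_rf_degree) auto
  then show ?thesis by simp
qed

text \<open>The equalizer of two automorphisms is a subfield.\<close>

lemma field_auto_eqI:
  assumes \<sigma>: "field_auto \<sigma>" "\<And>c. \<sigma> (rf_const c) = rf_const c"
    and \<tau>: "field_auto \<tau>" "\<And>c. \<tau> (rf_const c) = rf_const c"
    and eq: "\<sigma> rf_X = \<tau> rf_X"
  shows "\<sigma> = \<tau>"
proof -
  have "is_subfield {z. \<sigma> z = \<tau> z}"
    by (simp add: is_subfield_def field_auto_simps[OF \<sigma>(1)] field_auto_simps[OF \<tau>(1)])
  then have "{z. \<sigma> z = \<tau> z} = UNIV"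
    using \<sigma>(2) \<tau>(2) eq by (intro subfield_with_rf_X) auto
  then show ?thesis by auto
qed

lemma field_auts_over_adjoinD:
  assumes "\<sigma> \<in> field_auts_over (adjoin h)"
  shows "field_auto \<sigma>" "\<sigma> (rf_const c) = rf_const c" "\<sigma> h = h"
  using assms adjoin_const adjoin_self by (auto simp: field_auts_over_def)

text \<open>A constant \<open>h\<close> would shrink \<open>adjoin h\<close> to F_q, over which x is
  transcendental.\<close>

lemma rf_degree_pos:
  assumes "algebraic_over (adjoin h) rf_X"
  shows "0 < rf_degree h"
proof (rule ccontr)
  assume "\<not> 0 < rf_degree h"
  moreover obtain f g where fg: "is_reduced h f g" using ex_is_reduced by blast
  ultimately have "degree f = 0" "degree g = 0" by (simp_all add: rf_degree_eq)
  then obtain c d where "h = Fract [:c:] [:d:]" "d \<noteq> 0"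
    using fg by (auto simp: is_reduced_def elim!: degree_eq_zeroE)
  then have h: "h = rf_const (c / d)"
    by (simp add: divide_inverse Fract_conv_to_fract rf_const_eq_to_fract[symmetric])
  have "is_subfield (range (rf_const :: 'a \<Rightarrow> _))"
    unfolding is_subfield_def
    by (auto simp flip: rf_const_hom(3-7) intro: range_eqI[of _ _ 0] range_eqI[of _ _ 1])
  then have sub: "adjoin h \<subseteq> range rf_const" using h by (intro adjoin_least) auto
  obtain p where p: "p \<noteq> 0" "\<And>i. coeff p i \<in> adjoin h" "poly p rf_X = 0"
    using assms by (auto simp: algebraic_over_def)
  \<comment> \<open>Pulls the coefficients of \<open>p\<close> back to F_q, so that its value at x
    is the resulting polynomial itself and can vanish only trivially.\<close>
  define \<pi> where "\<pi> = inv_into UNIV (rf_const :: 'a \<Rightarrow> _)"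
  have \<pi>: "\<pi> (rf_const c) = c" for c
    unfolding \<pi>_def by (intro inv_f_f) (simp add: inj_def)
  then have \<pi>0: "\<pi> 0 = 0" by (metis rf_const_hom(1))
  have "map_poly rf_const (map_poly \<pi> p) = p"
  proof (rule poly_eqI)
    fix i
    obtain c where "coeff p i = rf_const c" using p(2) sub by blast
    then show "coeff (map_poly rf_const (map_poly \<pi> p)) i = coeff p i"
      using \<pi> \<pi>0 by (simp add: coeff_map_poly)
  qed
  then have "rf_eval (map_poly \<pi> p) rf_X = poly p rf_X" by (simp add: rf_eval_def)
  then have "map_poly \<pi> p = 0" using p(3) by (simp add: rf_eval_X)
  then show False
    using \<open>map_poly rf_const (map_poly \<pi> p) = p\<close> p(1) by simp
qed

text \<open>An automorphism is determined by the image of x, and this image is a root of f(X) - h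
  g(X), a nonzero polynomial of degree at most deg h.\<close>

lemma card_field_auts_over_le:
  assumes "0 < rf_degree h"
  shows "finite (field_auts_over (adjoin h))" "card (field_auts_over (adjoin h)) \<le> rf_degree h"
proof -
  let ?G = "field_auts_over (adjoin h)"
  obtain f g where fg: "is_reduced h f g" using ex_is_reduced by blast
  then have g: "g \<noteq> 0" "coprime f g" "h = Fract f g" by (auto simp: is_reduced_def)
  define R where "R = map_poly rf_const f - smult h (map_poly rf_const g)"
  have R: "poly R z = rf_eval f z - h * rf_eval g z" for z
    by (simp add: R_def rf_eval_def)
  have "R \<noteq> 0"
  proof
    assume "R = 0"
    then have c: "rf_const (coeff f i) = h * rf_const (coeff g i)" for i
      unfolding R_def by (metis coeff_map_poly coeff_smult rf_const_hom(1) right_minus_eq)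
    \<comment> \<open>The leading coefficient of \<open>g\<close> is invertible, so
      \<open>R = 0\<close> forces \<open>h\<close> to be this constant; coprimality then makes
      \<open>f\<close> and \<open>g\<close> constant.\<close>
    define k where "k = coeff f (degree g) * inverse (lead_coeff g)"
    have "h = rf_const k"
      using c[of "degree g"] g(1) by (simp add: k_def)
    then have "f = smult k g"
      by (intro poly_eqI) (metis c coeff_smult rf_const_hom(4,8))
    then have "g dvd 1" using g(2) by (metis coprime_common_divisor dvd_refl dvd_smult)
    then have "degree g = 0" using g(1) is_unit_iff_degree by blast
    then show False
      using assms \<open>f = smult k g\<close> by (simp add: rf_degree_eq[OF fg] split: if_splits)
  qed
  have degR: "degree R \<le> rf_degree h"
    unfolding R_def rf_degree_eq[OF fg]
    by (intro degree_diff_le order.trans[OF degree_smult_le])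
      (auto simp: degree_map_poly)
  have "rf_eval f rf_X - h * rf_eval g rf_X = 0"
    using g(1) by (simp add: rf_eval_X g(3) Fract_conv_to_fract)
  then have "poly R (\<sigma> rf_X) = 0" if "\<sigma> \<in> ?G" for \<sigma>
    using field_auts_over_adjoinD[OF that] rf_eval_hom[of \<sigma>] field_auto_simps[of \<sigma>]
    unfolding R by metis
  then have sub: "(\<lambda>\<sigma>. \<sigma> rf_X) ` ?G \<subseteq> {z. poly R z = 0}" by auto
  have inj: "inj_on (\<lambda>\<sigma>. \<sigma> rf_X) ?G"
    using field_auts_over_adjoinD by (intro inj_onI field_auto_eqI) auto
  have fin: "finite {z. poly R z = 0}" using \<open>R \<noteq> 0\<close> by (rule poly_roots_finite)
  then show "finite ?G" using sub inj finite_subset finite_imageD by blast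
  have "card ?G \<le> card {z. poly R z = 0}"
    using card_inj_on_le[OF inj sub fin] .
  then show "card ?G \<le> rf_degree h"
    using card_poly_roots_bound[OF \<open>R \<noteq> 0\<close>] degR by linarith
qed

text \<open>Artin's argument: the coefficients of the product of all X - \<sigma> x are fixed by the
  group, hence lie in F_q(h). Its degree is the order of the group and x is a root, so the order is
  at least deg h.\<close>

theorem order_galois_group:
  assumes "galois_over (adjoin h)"
  shows "finite (carrier (galois_group h))" "order (galois_group h) = rf_degree h"
proof -
  let ?G = "field_auts_over (adjoin h)"
  have pos: "0 < rf_degree h" using assms by (auto simp: galois_over_def intro: rf_degree_pos)
  note fin = card_field_auts_over_le(1)[OF pos]
  then show "finite (carrier (galois_group h))" by (simp add: galois_group_def)
  interpret group "galois_group h" by (rule group_galois_group)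
  define P where "P = (\<Prod>\<sigma>\<in>?G. [:- \<sigma> rf_X, 1:])"
  have deg: "degree P = card ?G"
    unfolding P_def by (subst degree_prod_sum_eq) auto
  have "P \<noteq> 0" using fin by (simp add: P_def)
  have "id \<in> ?G" by (simp add: field_auts_over_def field_auto_def)
  then have root: "poly P rf_X = 0"
    unfolding P_def poly_prod using fin by (intro prod_zero) (auto intro!: bexI[of _ id])
  have "coeff P i \<in> adjoin h" for i
  proof -
    have "\<tau> (coeff P i) = coeff P i" if \<tau>: "\<tau> \<in> ?G" for \<tau>
    proof -
      note T = field_auts_over_adjoinD(1)[OF \<tau>]
      \<comment> \<open>Composition with \<tau> permutes the group, and therefore the factors of
        \<open>P\<close>.\<close>
      have bij: "bij_betw (\<lambda>\<sigma>. \<tau> \<circ> \<sigma>) ?G ?G"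
      proof (rule bij_betw_byWitness[where f' = "\<lambda>\<sigma>. inv_into UNIV \<tau> \<circ> \<sigma>"])
        have c: "\<tau> \<in> carrier (galois_group h)" using \<tau> by (simp add: galois_group_def)
        have b: "bij \<tau>" using T by (simp add: field_auto_def)
        have "inv\<^bsub>galois_group h\<^esub> \<tau> \<circ> \<tau> = id" using l_inv[OF c] by (simp add: galois_group_def)
        \<comment> \<open>Identifies the inverse map with the group inverse, so that closure of the
          group applies to it.\<close>
        then have i: "inv_into UNIV \<tau> = inv\<^bsub>galois_group h\<^esub> \<tau>"
          using b by (metis bij_is_surj comp_assoc comp_id id_comp surj_iff)
        show "\<forall>\<sigma>\<in>?G. inv_into UNIV \<tau> \<circ> (\<tau> \<circ> \<sigma>) = \<sigma>" "\<forall>\<sigma>\<in>?G. \<tau> \<circ> (inv_into UNIV \<tau> \<circ> \<sigma>) = \<sigma>"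
          using b by (auto simp: fun_eq_iff bij_is_inj bij_is_surj surj_f_inv_f)
        show "(\<circ>) \<tau> ` ?G \<subseteq> ?G" "(\<circ>) (inv_into UNIV \<tau>) ` ?G \<subseteq> ?G"
          using m_closed[OF c] m_closed[OF inv_closed[OF c]]
          unfolding i by (auto simp: galois_group_def)
      qed
      have "map_poly \<tau> P = (\<Prod>\<sigma>\<in>?G. map_poly \<tau> [:- \<sigma> rf_X, 1:])"
        unfolding P_def by (intro map_poly_prod_hom) (simp_all add: field_auto_simps[OF T])
      also have "\<dots> = (\<Prod>\<sigma>\<in>?G. [:- (\<tau> \<circ> \<sigma>) rf_X, 1:])"
        using field_auto_simps(3)[OF T, of 0]
        by (intro prod.cong refl) (simp add: map_poly_pCons field_auto_simps[OF T])
      also have "\<dots> = P"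
        unfolding P_def by (rule prod.reindex_bij_betw[OF bij])
      finally show ?thesis
        using coeff_map_poly[of \<tau> P i] field_auto_simps(4)[OF T] by simp
    qed
    then show ?thesis using assms by (auto simp: galois_over_def)
  qed
  then have "rf_degree h \<le> degree P" using root \<open>P \<noteq> 0\<close> by (rule degree_ge_rf_degree)
  then show "order (galois_group h) = rf_degree h"
    using card_field_auts_over_le(2)[OF pos] deg by (simp add: order_def galois_group_def)
qed

subsection \<open>Classification of the rational places\<close>

definition place_at :: "'a::field \<Rightarrow> 'a ratfun set"
  where "place_at c = {Fract f g | f g. poly g c \<noteq> 0 \<and> poly f c = 0}"

text \<open>The inequality says that the valuation deg g - deg f at infinity is positive. As
  \<open>degree 0 = 0\<close>, the fraction 0 over a constant would fail it, hence the separate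
  case.\<close>

definition place_inf :: "'a::field ratfun set"
  where "place_inf = {Fract f g | f g. g \<noteq> 0 \<and> (f = 0 \<or> degree f < degree g)}"

text \<open>The denominator may itself vanish at \<open>c\<close>: this covers a fraction such as
  \<sigma> x - c, about whose denominator nothing is known beyond
  \<open>g \<noteq> 0\<close>.\<close>

lemma place_at_numerator:
  assumes "g \<noteq> 0" "Fract f g \<in> place_at c"
  shows "poly f c = 0"
proof -
  obtain f' g' where *: "Fract f g = Fract f' g'" "poly g' c \<noteq> 0" "poly f' c = 0"
    using assms(2) by (auto simp: place_at_def)
  then have "f * g' = f' * g" using assms(1) by (subst (asm) eq_fract) auto
  then have "poly f c * poly g' c = poly f' c * poly g c" by (metis poly_mult)
  then show ?thesis using * by simp
qed

lemma Fract_in_place_at: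
  assumes "poly g c \<noteq> 0"
  shows "Fract f g \<in> place_at c \<longleftrightarrow> poly f c = 0"
proof
  have "g \<noteq> 0" using assms by auto
  then show "Fract f g \<in> place_at c \<Longrightarrow> poly f c = 0" by (rule place_at_numerator)
qed (use assms in \<open>auto simp: place_at_def\<close>)

lemma coprime_poly_no_common_root:
  fixes f g :: "'a::field poly"
  assumes "coprime f g"
  shows "poly f c \<noteq> 0 \<or> poly g c \<noteq> 0"
proof -
  obtain a b where "a * f + b * g = 1" using coprime_poly_bezout[OF assms] by blast
  then have "poly a c * poly f c + poly b c * poly g c = 1" by (metis poly_1 poly_add poly_mult)
  then show ?thesis by auto
qed

lemma Fract_in_place_inf:
  assumes "g \<noteq> 0"
  shows "Fract f g \<in> place_inf \<longleftrightarrow> f = 0 \<or> degree f < degree g"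
proof
  assume "Fract f g \<in> place_inf"
  then obtain f' g' where *: "Fract f g = Fract f' g'" "g' \<noteq> 0" "f' = 0 \<or> degree f' < degree g'"
    by (auto simp: place_inf_def)
  then have eq: "f * g' = f' * g" using assms by (subst (asm) eq_fract) auto
  show "f = 0 \<or> degree f < degree g"
  proof (cases "f = 0")
    case False
    then have "f' \<noteq> 0" using eq * by auto
    then show ?thesis
      using arg_cong[OF eq, of degree] * False assms by (simp add: degree_mult_eq)
  qed simp
qed (use assms in \<open>auto simp: place_inf_def\<close>)

section \<open>The ideal of nonunits of a valuation ring\<close>

lemma valuation_ringD:
  assumes "valuation_ring V"
  shows "rf_const c \<in> V" "0 \<in> V" "1 \<in> V" "V \<noteq> UNIV"
    "\<And>a b. a \<in> V \<Longrightarrow> b \<in> V \<Longrightarrow> a - b \<in> V" "\<And>a b. a \<in> V \<Longrightarrow> b \<in> V \<Longrightarrow> a + b \<in> V"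
    "\<And>a b. a \<in> V \<Longrightarrow> b \<in> V \<Longrightarrow> a * b \<in> V" "\<And>z. z \<in> V \<or> inverse z \<in> V"
proof -
  show c: "rf_const c \<in> V" for c using assms by (auto simp: valuation_ring_def)
  show z: "0 \<in> V" and "1 \<in> V" using c[of 0] c[of 1] by simp_all
  show "V \<noteq> UNIV" "\<And>a b. a \<in> V \<Longrightarrow> b \<in> V \<Longrightarrow> a * b \<in> V" "\<And>z. z \<in> V \<or> inverse z \<in> V"
    and d: "\<And>a b. a \<in> V \<Longrightarrow> b \<in> V \<Longrightarrow> a - b \<in> V"
    using assms by (auto simp: valuation_ring_def)
  show "a + b \<in> V" if "a \<in> V" "b \<in> V" for a b
    using d[OF that(1) d[OF z that(2)]] by simp
qed

text \<open>The case \<open>z = 0\<close> is listed because \<open>inverse 0 = 0\<close> does lie in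
  \<open>V\<close>.\<close>

lemma nonunits_iff:
  assumes "valuation_ring V"
  shows "z \<in> nonunits V \<longleftrightarrow> z \<in> V \<and> (z = 0 \<or> inverse z \<notin> V)"
proof -
  have "(\<exists>w\<in>V. z * w = 1) \<longleftrightarrow> z \<noteq> 0 \<and> inverse z \<in> V"
    using inverse_unique[of z] by (cases "z = 0") (auto intro!: bexI[of _ "inverse z"])
  then show ?thesis by (auto simp: nonunits_def)
qed

lemma inverse_in_nonunits: "valuation_ring V \<Longrightarrow> z \<notin> V \<Longrightarrow> inverse z \<in> nonunits V"
  by (metis nonunits_iff inverse_inverse_eq valuation_ringD(8))

lemma nonunits_mult:
  assumes "valuation_ring V" "a \<in> V" "z \<in> nonunits V"
  shows "a * z \<in> nonunits V"
proof -
  have "a * z * w \<noteq> 1" if "w \<in> V" for w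
  proof -
    have "a * w \<in> V" using assms(2) that by (rule valuation_ringD(7)[OF assms(1)])
    then have "z * (a * w) \<noteq> 1" using assms(3) by (auto simp: nonunits_def)
    then show ?thesis by (simp add: mult_ac)
  qed
  then show ?thesis
    using assms(2,3) valuation_ringD(7)[OF assms(1)] by (auto simp: nonunits_def)
qed

text \<open>One of b/a and a/b lies in \<open>V\<close>, so the sum is a multiple in
  \<open>V\<close> of one summand.\<close>

lemma nonunits_add:
  assumes V: "valuation_ring V" and a: "a \<in> nonunits V" and b: "b \<in> nonunits V"
  shows "a + b \<in> nonunits V"
proof -
  have *: "x + y \<in> nonunits V" if "x \<noteq> 0" "y / x \<in> V" "x \<in> nonunits V" for x y
  proof -
    have "(1 + y / x) * x \<in> nonunits V"
      using that V by (intro nonunits_mult valuation_ringD(6)) (auto intro: valuation_ringD)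
    then show ?thesis using that(1) by (simp add: distrib_right)
  qed
  have "b / a \<in> V \<or> a / b \<in> V" using valuation_ringD(8)[OF V, of "b / a"] by simp
  then show ?thesis
    using *[of a b] *[of b a] a b by (cases "a = 0 \<or> b = 0") (auto simp: add.commute)
qed

lemma nonunits_uminus: "valuation_ring V \<Longrightarrow> z \<in> nonunits V \<Longrightarrow> - z \<in> nonunits V"
  using nonunits_mult[of V "rf_const (-1)" z] valuation_ringD(1)[of V "-1"] by simp

lemma nonunits_diff:
  "valuation_ring V \<Longrightarrow> a \<in> nonunits V \<Longrightarrow> b \<in> nonunits V \<Longrightarrow> a - b \<in> nonunits V"
  using nonunits_add[of V a "- b"] nonunits_uminus[of V b] by simp

lemma rf_const_in_nonunits: "valuation_ring V \<Longrightarrow> rf_const c \<in> nonunits V \<longleftrightarrow> c = 0"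
  using valuation_ringD(1)[of V "inverse c"] valuation_ringD(1)[of V c]
  by (auto simp: nonunits_iff)

text \<open>Reduces the identification of a place to one inclusion. An element of the larger ideal
  lies in \<open>W\<close>; its residue constant there again belongs to the larger ideal and must be
  0.\<close>

lemma rational_place_eqI:
  assumes V: "valuation_ring V"
    and W: "valuation_ring W" "\<And>z. z \<in> W \<Longrightarrow> \<exists>c. z - rf_const c \<in> nonunits W"
    and sub: "nonunits W \<subseteq> nonunits V"
  shows "nonunits V = nonunits W"
proof (intro equalityI sub subsetI)
  fix z assume z: "z \<in> nonunits V"
  have "z \<in> W"
  proof (rule ccontr)
    assume "z \<notin> W"
    then have "inverse z \<in> nonunits V" "z \<noteq> 0"
      using inverse_in_nonunits[OF W(1)] sub valuation_ringD(2)[OF W(1)] by auto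
    then show False using z by (auto simp: nonunits_iff[OF V])
  qed
  then obtain c where c: "z - rf_const c \<in> nonunits W" using W(2) by blast
  then have "z - (z - rf_const c) \<in> nonunits V"
    using z sub by (blast intro: nonunits_diff[OF V])
  then have "c = 0" by (simp add: rf_const_in_nonunits[OF V])
  then show "z \<in> nonunits W" using c by simp
qed

section \<open>The valuation rings at \<open>c\<close> and at infinity\<close>

lemma Fract_minus_rf_const:
  "g \<noteq> 0 \<Longrightarrow> Fract f g - rf_const c = Fract (f - smult c g) g"
  by (simp add: rf_const_def)

lemma rational_place_at:
  fixes c :: "'a::field"
  obtains V where "valuation_ring V" "nonunits V = place_at c"
    "\<And>z. z \<in> V \<Longrightarrow> \<exists>k. z - rf_const k \<in> nonunits V"
proof -
  define V where "V = {Fract f g | f g. poly g c \<noteq> 0}"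
  have mem: "Fract f g \<in> V" if "poly g c \<noteq> 0" for f g using that by (auto simp: V_def)
  have nz: "g \<noteq> 0" if "poly g c \<noteq> 0" for g using that by auto
  \<comment> \<open>The right side of \<open>nonunits_iff\<close>, written out because
    \<open>V\<close> is not yet known to be a valuation ring.\<close>
  have P: "z \<in> V \<and> (z = 0 \<or> inverse z \<notin> V) \<longleftrightarrow> z \<in> place_at c" for z
  proof -
    obtain f g where r: "is_reduced z f g" using ex_is_reduced by blast
    then have z: "z = Fract f g" "g \<noteq> 0" "coprime f g" by (auto simp: is_reduced_def)
    have 1: "inverse z \<notin> V" if zP: "z \<in> place_at c" "z \<noteq> 0"
    proof
      assume "inverse z \<in> V"
      then obtain f' g' where *: "inverse z = Fract f' g'" "poly g' c \<noteq> 0" by (auto simp: V_def)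
      have "z = Fract g' f'" using *(1) by (metis inverse_fract inverse_inverse_eq)
      then have "f' \<noteq> 0" using zP(2) by (auto simp: fract_collapse)
      then have "f * f' = g' * g" using \<open>z = Fract g' f'\<close> z by (simp add: eq_fract)
      then have "poly f c * poly f' c = poly g' c * poly g c" by (metis poly_mult)
      moreover have "poly f c = 0" using place_at_numerator zP(1) z by blast
      ultimately show False using coprime_poly_no_common_root[OF z(3), of c] *(2) by auto
    qed
    have 2: "z \<in> V" if "z \<in> place_at c"
      using that mem by (auto simp: place_at_def)
    have 3: "z \<in> place_at c" if zV: "z \<in> V" "inverse z \<notin> V"
    proof -
      obtain f' g' where *: "z = Fract f' g'" "poly g' c \<noteq> 0" using zV(1) by (auto simp: V_def)
      then have "poly f' c = 0" using zV(2) mem[of f' g'] by (metis inverse_fract mem)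
      then show ?thesis using * by (auto simp: place_at_def)
    qed
    have "0 \<in> place_at c" using Fract_in_place_at[of 1 c 0] by (simp add: fract_collapse)
    then show ?thesis using 1 2 3 by blast
  qed
  have const: "rf_const k \<in> V" for k using mem[of 1 "[:k:]"] by (simp add: rf_const_def)
  \<comment> \<open>The uniformizer x - c witnesses both strict inclusions: it is not constant, and
    its inverse lies outside \<open>V\<close>.\<close>
  let ?t = "Fract [:- c, 1:] 1 :: 'a ratfun"
  have t: "?t \<in> place_at c" by (subst Fract_in_place_at) simp_all
  have "?t \<noteq> 0" by (simp add: Zero_fract_def eq_fract)
  then have t': "?t \<in> V" "inverse ?t \<notin> V" using P[of ?t] t by blast+
  have "?t \<noteq> rf_const k" for k by (simp add: rf_const_def eq_fract)
  then have "range rf_const \<subset> V" using const t' by blast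
  moreover have "V \<subset> UNIV" using t' by blast
  moreover have "a - b \<in> V \<and> a * b \<in> V" if "a \<in> V" "b \<in> V" for a b
  proof -
    obtain f g f' g' where *: "a = Fract f g" "poly g c \<noteq> 0" "b = Fract f' g'" "poly g' c \<noteq> 0"
      using \<open>a \<in> V\<close> \<open>b \<in> V\<close> by (auto simp: V_def)
    then show ?thesis using nz by (simp add: mem)
  qed
  moreover have "z \<in> V \<or> inverse z \<in> V" for z
  proof -
    obtain f g where r: "is_reduced z f g" using ex_is_reduced by blast
    then have z: "z = Fract f g" "coprime f g" by (auto simp: is_reduced_def)
    show ?thesis using coprime_poly_no_common_root[OF z(2), of c] mem z(1) by auto
  qed
  ultimately have V: "valuation_ring V" unfolding valuation_ring_def by blast
  then have N: "nonunits V = place_at c" using P nonunits_iff by blast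
  have "\<exists>k. z - rf_const k \<in> place_at c" if zV: "z \<in> V" for z
  proof -
    obtain f g where z: "z = Fract f g" "poly g c \<noteq> 0" using zV by (auto simp: V_def)
    have "z - rf_const (poly f c / poly g c) \<in> place_at c"
      using z nz by (simp add: Fract_minus_rf_const Fract_in_place_at)
    then show ?thesis by blast
  qed
  then show ?thesis using that V N by metis
qed

lemma rational_place_inf:
  obtains V :: "'a::field ratfun set" where "valuation_ring V" "nonunits V = place_inf"
    "\<And>z. z \<in> V \<Longrightarrow> \<exists>k. z - rf_const k \<in> nonunits V"
proof -
  define V where "V = {Fract f g | f g :: 'a poly. g \<noteq> 0 \<and> degree f \<le> degree g}"
  have mem: "Fract f g \<in> V \<longleftrightarrow> degree f \<le> degree g" if g: "g \<noteq> 0" for f g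
  proof
    assume "Fract f g \<in> V"
    then obtain f' g' where *: "Fract f g = Fract f' g'" "g' \<noteq> 0" "degree f' \<le> degree g'"
      by (auto simp: V_def)
    then have eq: "f * g' = f' * g" using g by (simp add: eq_fract)
    show "degree f \<le> degree g"
    proof (cases "f = 0")
      case False
      then have "f' \<noteq> 0" using eq * by auto
      then show ?thesis using arg_cong[OF eq, of degree] * False g by (simp add: degree_mult_eq)
    qed simp
  qed (use g in \<open>auto simp: V_def\<close>)
  have P: "z \<in> V \<and> (z = 0 \<or> inverse z \<notin> V) \<longleftrightarrow> z \<in> place_inf" for z
  proof -
    obtain f g where "is_reduced z f g" using ex_is_reduced by blast
    then have z: "z = Fract f g" "g \<noteq> 0" by (auto simp: is_reduced_def)
    show ?thesis
    proof (cases "f = 0")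
      case True
      then show ?thesis using z mem[of g 0] Fract_in_place_inf[of g 0] by (simp add: fract_collapse)
    next
      case False
      then have "z \<noteq> 0" using z by (simp add: Zero_fract_def eq_fract)
      then show ?thesis using z False by (auto simp: mem Fract_in_place_inf)
    qed
  qed
  have const: "rf_const k \<in> V" for k by (simp add: rf_const_def mem)
  let ?t = "Fract 1 [:0, 1:] :: 'a ratfun"
  have t': "?t \<in> V" "inverse ?t \<notin> V" by (simp_all add: mem)
  have "?t \<noteq> rf_const k" for k by (simp add: rf_const_def eq_fract one_pCons)
  then have "range rf_const \<subset> V" using const t' by blast
  moreover have "V \<subset> UNIV" using t' by blast
  moreover have "a - b \<in> V \<and> a * b \<in> V" if "a \<in> V" "b \<in> V" for a b
  proof -
    obtain f g f' g' where *: "a = Fract f g" "g \<noteq> 0" "degree f \<le> degree g"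
      "b = Fract f' g'" "g' \<noteq> 0" "degree f' \<le> degree g'"
      using \<open>a \<in> V\<close> \<open>b \<in> V\<close> by (auto simp: V_def)
    have "degree (f * g') \<le> degree g + degree g'" "degree (f' * g) \<le> degree g + degree g'"
      "degree (f * f') \<le> degree g + degree g'"
      using * degree_mult_le[of f g'] degree_mult_le[of f' g] degree_mult_le[of f f'] by linarith+
    then show ?thesis using * by (simp add: mem degree_mult_eq degree_diff_le)
  qed
  moreover have "z \<in> V \<or> inverse z \<in> V" for z
  proof -
    obtain f g where "is_reduced z f g" using ex_is_reduced by blast
    then have z: "z = Fract f g" "g \<noteq> 0" by (auto simp: is_reduced_def)
    then show ?thesis by (cases "f = 0") (auto simp: mem)
  qed
  ultimately have V: "valuation_ring V" unfolding valuation_ring_def by blast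
  then have N: "nonunits V = place_inf" using P nonunits_iff by blast
  have "\<exists>k. z - rf_const k \<in> place_inf" if zV: "z \<in> V" for z
  proof -
    obtain f g where z: "z = Fract f g" "g \<noteq> 0" "degree f \<le> degree g"
      using zV by (auto simp: V_def)
    \<comment> \<open>The residue at infinity is the quotient of the coefficients in degree
      \<open>degree g\<close>; it is 0 when \<open>f\<close> has smaller degree.\<close>
    let ?r = "f - smult (coeff f (degree g) / lead_coeff g) g"
    have "?r = 0 \<or> degree ?r < degree g"
    proof -
      have "degree ?r \<le> degree g" using z(3)
        by (intro degree_diff_le) (auto intro: order.trans[OF degree_smult_le])
      moreover have "coeff ?r (degree g) = 0" using z(2) by simp
      ultimately show ?thesis by (metis le_neq_implies_less leading_coeff_0_iff)
    qed
    then have "z - rf_const (coeff f (degree g) / lead_coeff g) \<in> place_inf"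
      using z by (simp add: Fract_minus_rf_const Fract_in_place_inf)
    then show ?thesis by blast
  qed
  then show ?thesis using that V N by metis
qed

section \<open>Every rational place is one of these\<close>

lemma rf_X_minus_rf_const: "rf_X - rf_const c = Fract [:- c, 1:] 1"
  unfolding rf_X_def rf_const_eq_to_fract to_fract_diff[symmetric] by (simp add: to_fract_def)

text \<open>Such a ring contains F_q[x], and modulo its nonunits a polynomial reduces to its value
  at \<open>c\<close>. Denominators that do not vanish at \<open>c\<close> are therefore
  units.\<close>

lemma place_at_subset:
  assumes V: "valuation_ring V" and t: "rf_X - rf_const c \<in> nonunits V"
  shows "place_at c \<subseteq> nonunits V"
proof
  have "rf_X - rf_const c + rf_const c \<in> V"
    using t valuation_ringD(1,6)[OF V] nonunits_iff[OF V] by blast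
  then have X: "rf_X \<in> V" by simp
  have poly: "to_fract p \<in> V" for p
  proof -
    have "rf_eval p rf_X \<in> V" by (induction p) (auto intro!: valuation_ringD[OF V] X)
    then show ?thesis by (simp add: rf_eval_X)
  qed
  have res: "to_fract p - rf_const (poly p c) \<in> nonunits V" for p
  proof -
    obtain q where q: "p - [:poly p c:] = [:- c, 1:] * q"
      using poly_eq_0_iff_dvd[of "p - [:poly p c:]" c] by auto
    have "rf_X - rf_const c = to_fract [:- c, 1:]"
      by (simp add: rf_X_minus_rf_const to_fract_def)
    then have "to_fract p - rf_const (poly p c) = to_fract q * (rf_X - rf_const c)"
      unfolding rf_const_eq_to_fract to_fract_diff[symmetric] q by (metis mult.commute to_fract_mult)
    then show ?thesis using nonunits_mult[OF V poly t] by simp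
  qed
  fix z assume "z \<in> place_at c"
  then obtain f g where z: "z = Fract f g" "poly g c \<noteq> 0" "poly f c = 0"
    by (auto simp: place_at_def)
  have "to_fract g \<notin> nonunits V"
  proof
    assume "to_fract g \<in> nonunits V"
    then have "to_fract g - (to_fract g - rf_const (poly g c)) \<in> nonunits V"
      using res by (rule nonunits_diff[OF V])
    then show False using z by (simp add: rf_const_in_nonunits[OF V])
  qed
  then have "inverse (to_fract g) \<in> V" using poly by (simp add: nonunits_iff[OF V])
  then have "inverse (to_fract g) * to_fract f \<in> nonunits V"
    using res[of f] z(3) by (intro nonunits_mult[OF V]) simp_all
  then show "z \<in> nonunits V"
    by (simp add: z(1) Fract_conv_to_fract divide_inverse mult.commute)
qed

text \<open>The analogue with 1/x: dividing numerator and denominator by the same power of x leaves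
  a nonunit over a unit.\<close>

lemma place_inf_subset:
  fixes V :: "'a::field ratfun set"
  assumes V: "valuation_ring V" and t: "inverse rf_X \<in> nonunits V"
  shows "place_inf \<subseteq> nonunits V"
proof
  have X0: "rf_X \<noteq> (0 :: 'a ratfun)" by (simp add: rf_X_def)
  \<comment> \<open>The exponent is any bound on the degree, because \<open>f\<close> is to be
    divided by the power of x that belongs to \<open>g\<close>.\<close>
  have res: "to_fract p * inverse rf_X ^ n - rf_const (coeff p n) \<in> nonunits V"
    if "degree p \<le> n" for p :: "'a poly" and n
    using that
  proof (induction n arbitrary: p)
    case 0
    then obtain c where "p = [:c:]" by (auto elim: degree_eq_zeroE)
    then show ?case using rf_const_in_nonunits[OF V, of 0] by (simp add: rf_const_eq_to_fract)
  next
    case (Suc n)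
    obtain a q where p: "p = pCons a q" by (cases p)
    then have q: "degree q \<le> n" using Suc.prems by (auto split: if_splits)
    have iV: "inverse rf_X ^ k \<in> V" for k
      using t by (induction k) (auto intro!: valuation_ringD[OF V] simp: nonunits_iff[OF V])
    have "rf_const a * inverse rf_X ^ n * inverse rf_X \<in> nonunits V"
      using t by (intro nonunits_mult[OF V] valuation_ringD[OF V] iV)
    from nonunits_add[OF V this Suc.IH[OF q]]
    show ?case
      using X0 unfolding p rf_eval_X[symmetric] by (simp add: field_simps)
  qed
  fix z :: "'a ratfun" assume "z \<in> place_inf"
  then obtain f g where z: "z = Fract f g" "g \<noteq> 0" "f = 0 \<or> degree f < degree g"
    by (auto simp: place_inf_def)
  let ?n = "degree g"
  have f: "to_fract f * inverse rf_X ^ ?n \<in> nonunits V"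
    using res[of f ?n] z(3) by (auto simp: coeff_eq_0)
  let ?g = "to_fract g * inverse rf_X ^ ?n"
  have "?g \<notin> nonunits V"
  proof
    assume "?g \<in> nonunits V"
    then have "?g - (?g - rf_const (lead_coeff g)) \<in> nonunits V"
      using res by (rule nonunits_diff[OF V]) simp
    then show False using z by (simp add: rf_const_in_nonunits[OF V])
  qed
  moreover have "inverse ?g \<in> V \<or> ?g \<in> V" using valuation_ringD(8)[OF V] by blast
  ultimately have "inverse ?g \<in> V" by (auto simp: nonunits_iff[OF V])
  then have "inverse ?g * (to_fract f * inverse rf_X ^ ?n) \<in> nonunits V"
    using f by (rule nonunits_mult[OF V])
  then show "z \<in> nonunits V"
    using X0 by (simp add: z(1) Fract_conv_to_fract field_simps)
qed

text \<open>A place is located by the residue of x if x lies in its ring, and is the infinite one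
  otherwise.\<close>

theorem rational_places_eq: "rational_places = insert place_inf (range place_at)"
proof (intro equalityI subsetI)
  fix P :: "'a ratfun set" assume "P \<in> rational_places"
  then obtain V where V: "P = nonunits V" "valuation_ring V"
    and res: "\<And>z. z \<in> V \<Longrightarrow> \<exists>c. z - rf_const c \<in> nonunits V"
    by (auto simp: rational_places_def)
  show "P \<in> insert place_inf (range place_at)"
  proof (cases "rf_X \<in> V")
    case True
    then obtain c where "rf_X - rf_const c \<in> nonunits V" using res by blast
    then have "place_at c \<subseteq> nonunits V" using place_at_subset V(2) by blast
    then have "P = place_at c"
      using V rational_place_eqI by (metis rational_place_at)
    then show ?thesis by blast
  next
    case False
    then have "place_inf \<subseteq> nonunits V" using V(2) by (intro place_inf_subset inverse_in_nonunits)
    then have "P = place_inf"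
      using V rational_place_eqI by (metis rational_place_inf)
    then show ?thesis by blast
  qed
next
  fix P :: "'a ratfun set" assume "P \<in> insert place_inf (range place_at)"
  then consider "P = place_inf" | c where "P = place_at c" by blast
  then obtain V where "valuation_ring V" "nonunits V = P"
    "\<And>z. z \<in> V \<Longrightarrow> \<exists>c. z - rf_const c \<in> nonunits V"
  proof cases
    case 1
    then show ?thesis using that rational_place_inf by metis
  next
    case 2
    then show ?thesis using that rational_place_at by metis
  qed
  then show "P \<in> rational_places" unfolding rational_places_def by blast
qed

text \<open>The element x - c serves as a test that tells the places apart.\<close>

lemma rf_X_minus_in_place_at: "rf_X - rf_const c \<in> place_at d \<longleftrightarrow> c = d"
  by (auto simp: rf_X_minus_rf_const Fract_in_place_at)

lemma inj_place_at: "inj place_at"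
  by (rule injI) (metis rf_X_minus_in_place_at)

lemma place_inf_neq_place_at: "place_inf \<noteq> place_at c"
proof -
  have "rf_X - rf_const c \<notin> place_inf" by (simp add: rf_X_minus_rf_const Fract_in_place_inf)
  then show ?thesis using rf_X_minus_in_place_at by metis
qed

lemma card_rational_places:
  "finite (rational_places :: 'a::{field, finite} ratfun set set)"
  "card (rational_places :: 'a::{field, finite} ratfun set set) = CARD('a) + 1"
  using place_inf_neq_place_at
  by (auto simp: rational_places_eq card_image[OF inj_place_at] card_insert_if)

subsection \<open>Counting orbits\<close>

lemma (in group_action) orbit_card_dvd_order:
  assumes "B \<in> orbits G E \<phi>"
  shows "card B dvd order G"
  using assms orbit_stabilizer_theorem by (auto simp: orbits_def) (metis dvd_triv_left)

text \<open>
  Write \<open>n = order G\<close>, let \<open>s\<close> and \<open>b\<close> be the number and the total size of the short orbits and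
  \<open>l\<close> the number of long ones.  Then \<open>card E = l * n + b\<close>, and Burnside's lemma gives
  \<open>(l + s) * n \<le> card E + 2 * (n - 1)\<close>, hence \<open>s * n + 2 \<le> b + 2 * n\<close>.  As \<open>2 * b \<le> s * n\<close>, this
  forces \<open>s \<le> 3\<close>, and it places \<open>b / n\<close> in \<open>{0}\<close>, \<open>(0, 1/2]\<close>, \<open>(0, 1]\<close>, \<open>(1, 3/2]\<close> for
  \<open>s = 0, 1, 2, 3\<close>.
\<close>

theorem (in group_action) orbit_count_two_fixed_points:
  assumes fin: "finite (carrier G)" "finite E"
    and two: "\<And>g. g \<in> carrier G \<Longrightarrow> g \<noteq> \<one> \<Longrightarrow> card (invariants E \<phi> g) \<le> 2"
  defines "S \<equiv> {B \<in> orbits G E \<phi>. card B \<noteq> order G}"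
  shows "finite S" "card S \<le> 3"
    "card S \<in> {0, 1} \<Longrightarrow> int (card (orbits G E \<phi>)) = \<lceil>real (card E) / real (order G)\<rceil>"
    "card S \<in> {2, 3} \<Longrightarrow> int (card (orbits G E \<phi>)) = \<lceil>real (card E) / real (order G)\<rceil> + 1"
proof -
  interpret group G using group_hom group_hom.axioms(1) by blast
  define n where "n = order G"
  define L where "L = {B \<in> orbits G E \<phi>. card B = n}"
  define b where "b = (\<Sum>B\<in>S. card B)"
  have n: "n > 0" using fin(1) by (simp add: n_def order_gt_0_iff_finite)
  have finO: "finite (orbits G E \<phi>)" using fin(2) by (simp add: orbits_def)
  have O: "orbits G E \<phi> = L \<union> S" "L \<inter> S = {}" by (auto simp: L_def S_def n_def)
  show finS: "finite S" using finO O by simp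
  have finL: "finite L" using finO O by simp
  have cardO: "card (orbits G E \<phi>) = card L + card S"
    using O finS finL by (simp add: card_Un_disjoint)
  have "card E = (\<Sum>B\<in>orbits G E \<phi>. card B)"
    using disjoint_sum[OF fin(2), of "\<lambda>_. 1 :: nat"] by simp
  moreover have "(\<Sum>B\<in>L. card B) = card L * n" by (simp add: L_def)
  ultimately have cardE: "card E = card L * n + b"
    using O finS finL by (simp add: sum.union_disjoint b_def)
  \<comment> \<open>The size of a short orbit is a proper divisor of \<open>n\<close>, hence at most
    half of it.\<close>
  have card_S: "0 < card B \<and> 2 * card B \<le> n" if "B \<in> S" for B
  proof -
    have "card B dvd n" "card B \<noteq> n"
      using that orbit_card_dvd_order by (auto simp: S_def n_def)
    then obtain k where k: "n = card B * k" "k \<noteq> 1" by (auto elim: dvdE)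
    then have "k \<noteq> 0" using n by (metis mult_0_right less_irrefl)
    then have "2 \<le> k" using k(2) by simp
    then have "card B * 2 \<le> n" unfolding k(1) by (rule mult_le_mono2)
    then show ?thesis using n k(1) by (metis mult.commute mult_0 gr0I less_irrefl)
  qed
  have b_ge: "card S \<le> b"
    using sum_mono[of S "\<lambda>_. 1" card] card_S by (force simp: b_def)
  have b_le: "2 * b \<le> card S * n"
    using sum_bounded_above[of S "\<lambda>B. 2 * card B" n] card_S by (simp add: b_def sum_distrib_left)
  have "(card L + card S) * n = (\<Sum>g\<in>carrier G. card (invariants E \<phi> g))"
    using burnside[OF fin] by (simp add: cardO n_def)
  also have "\<dots> = card (invariants E \<phi> \<one>) + (\<Sum>g\<in>carrier G - {\<one>}. card (invariants E \<phi> g))"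
    using fin(1) by (intro sum.remove) simp_all
  also have "\<dots> \<le> card E + (\<Sum>g\<in>carrier G - {\<one>}. 2)"
    using two fin(2) by (intro add_mono card_mono sum_mono) (auto simp: invariants_def)
  also have "\<dots> = card E + 2 * (n - 1)"
    using fin(1) by (simp add: n_def order_def)
  \<comment> \<open>The 2 is moved to the left to remove the truncated subtraction
    \<open>n - 1\<close>, which is exact as \<open>n > 0\<close>.\<close>
  finally have key: "card S * n + 2 \<le> b + 2 * n"
    using n cardE by (simp add: algebra_simps)
  show S3: "card S \<le> 3"
  proof (rule ccontr)
    assume "\<not> card S \<le> 3"
    then have "4 * n \<le> card S * n" by (intro mult_le_mono1) simp
    then show False using key b_le by linarith
  qed
  have ceil: "\<lceil>real (card E) / real (order G)\<rceil> = int m"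
    if "card E \<le> m * n" "m * n < card E + n" for m
  proof (rule ceiling_unique)
    have "real (card E) \<le> real m * real n"
      using that(1) by (metis of_nat_le_iff of_nat_mult)
    then show "real (card E) / real (order G) \<le> of_int (int m)"
      using n by (simp add: n_def pos_divide_le_eq)
    have "real m * real n < real (card E) + real n"
      using that(2) by (metis of_nat_add of_nat_less_iff of_nat_mult)
    then show "of_int (int m) - 1 < real (card E) / real (order G)"
      using n by (subst pos_less_divide_eq) (simp_all add: n_def left_diff_distrib)
  qed
  show "int (card (orbits G E \<phi>)) = \<lceil>real (card E) / real (order G)\<rceil>" if "card S \<in> {0, 1}"
    using that b_ge b_le n
    by (intro ceil[symmetric]) (auto simp: cardO cardE algebra_simps)
  show "int (card (orbits G E \<phi>)) = \<lceil>real (card E) / real (order G)\<rceil> + 1" if "card S \<in> {2, 3}"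
  proof -
    \<comment> \<open>Two short orbits hold between 1 and \<open>n\<close> points and add 1 to the
      ceiling. Three hold more than \<open>n\<close> by \<open>key\<close> and at most 3n/2 by
      \<open>b_le\<close>, and add 2.\<close>
    have "\<lceil>real (card E) / real (order G)\<rceil> = int (card L + card S - 1)"
      using that b_ge b_le key n
      by (intro ceil) (auto simp: cardE algebra_simps)
    then show ?thesis using that by (auto simp: cardO)
  qed
qed

text \<open>
  A rational place \<open>place_at c\<close> fixed by the automorphism \<open>rf_X \<mapsto> f / g\<close> is a root \<open>c\<close> of
  \<open>f - rf_X * g\<close>, which has degree at most two, and at most one if \<open>place_inf\<close> is fixed as well.
\<close>

lemma card_fixed_rational_places_le:
  fixes \<sigma> :: "'a::{field, finite} ratfun \<Rightarrow> 'a ratfun"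
  assumes \<sigma>: "field_auto \<sigma>" "\<And>c. \<sigma> (rf_const c) = rf_const c" and "\<sigma> \<noteq> id"
  shows "card {P \<in> rational_places. \<sigma> ` P = P} \<le> 2"
proof -
  obtain f g where fg: "is_reduced (\<sigma> rf_X) f g" using ex_is_reduced by blast
  then have g: "g \<noteq> 0" "\<sigma> rf_X = Fract f g" by (auto simp: is_reduced_def)
  have deg: "degree f \<le> 1" "degree g \<le> 1"
    using rf_degree_field_auto_rf_X[OF \<sigma>] rf_degree_eq[OF fg] by simp_all
  define q where "q = f - [:0, 1:] * g"
  have "q \<noteq> 0"
  proof
    assume "q = 0"
    then have "f = [:0, 1:] * g" by (simp only: q_def right_minus_eq)
    then have "\<sigma> rf_X = id rf_X"
      using g by (simp add: rf_X_def to_fract_def eq_fract)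
    then have "\<sigma> = id"
      by (rule field_auto_eqI[OF \<sigma>, rotated 2]) (auto simp: field_auto_def simp flip: id_def)
    then show False using \<open>\<sigma> \<noteq> id\<close> by simp
  qed
  have degX: "degree ([:0, 1:] * g) \<le> Suc (degree g)" by simp
  have at: "poly q c = 0" if "\<sigma> ` place_at c = place_at c" for c
  proof -
    \<comment> \<open>The image of x - c has numerator f - c g, which takes the same value at
      \<open>c\<close> as \<open>q\<close>.\<close>
    have "rf_X - rf_const c \<in> place_at c" by (simp add: rf_X_minus_in_place_at)
    then have "\<sigma> (rf_X - rf_const c) \<in> place_at c" using that by blast
    then have "Fract f g - rf_const c \<in> place_at c"
      by (simp add: field_auto_simps[OF \<sigma>(1)] \<sigma>(2) g(2))
    then have "poly (f - smult c g) c = 0"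
      using g(1) by (metis Fract_minus_rf_const place_at_numerator)
    then show ?thesis by (simp add: q_def)
  qed
  have inf: "degree q \<le> 1" if "\<sigma> ` place_inf = place_inf"
  proof -
    \<comment> \<open>The image g/f of 1/x must again vanish at infinity. With both degrees at most
      one, \<open>g\<close> is then constant and the quadratic term of \<open>q\<close> drops
      out.\<close>
    have "inverse rf_X \<in> (place_inf :: 'a ratfun set)"
      by (simp add: rf_X_def to_fract_def Fract_in_place_inf)
    then have "\<sigma> (inverse rf_X) \<in> place_inf" using that by blast
    then have "Fract g f \<in> place_inf" by (simp add: field_auto_simps[OF \<sigma>(1)] g(2))
    moreover have "f \<noteq> 0"
    proof
      assume "f = 0"
      then have "\<sigma> rf_X = \<sigma> 0" by (simp add: g(2) field_auto_simps[OF \<sigma>(1)] fract_collapse)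
      then have "rf_X = (0 :: 'a ratfun)" using field_auto_simps(7)[OF \<sigma>(1)] by blast
      then show False by (simp add: rf_X_def)
    qed
    ultimately have "degree g < degree f" using g(1) by (simp add: Fract_in_place_inf)
    then show ?thesis
      unfolding q_def using deg degX by (intro degree_diff_le) linarith+
  qed
  let ?F = "{P \<in> rational_places. \<sigma> ` P = P}"
  let ?R = "place_at ` {c. poly q c = 0}"
  have card_R: "card ?R \<le> degree q"
    using card_poly_roots_bound[OF \<open>q \<noteq> 0\<close>] card_image_le[of "{c. poly q c = 0}" place_at]
    by (meson finite le_trans)
  show ?thesis
  proof (cases "\<sigma> ` place_inf = place_inf")
    case True
    have "?F \<subseteq> insert place_inf ?R" using at by (auto simp: rational_places_eq)
    then have "card ?F \<le> card (insert place_inf ?R)" by (intro card_mono) auto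
    also have "\<dots> \<le> Suc (card ?R)" by (rule card_insert_le_m1) simp_all
    finally show ?thesis using card_R inf[OF True] by linarith
  next
    case False
    have "?F \<subseteq> ?R" using at False by (auto simp: rational_places_eq)
    then have "card ?F \<le> card ?R" by (intro card_mono) auto
    moreover have "degree q \<le> 2"
      unfolding q_def using deg degX by (intro degree_diff_le) linarith+
    ultimately show ?thesis using card_R by linarith
  qed
qed

theorem theorem5p1:
  fixes h :: "'a::{field, finite} ratfun"
  assumes "galois_over (adjoin h)"
  shows "(finite (short_orbits h) \<and> card (short_orbits h) \<le> 3) \<and>
    (card (short_orbits h) \<in> {0, 1} \<longrightarrow>
      int (card (place_orbits h)) = \<lceil>(real CARD('a) + 1) / real (rf_degree h)\<rceil>) \<and>
    (card (short_orbits h) \<in> {2, 3} \<longrightarrow>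
      int (card (place_orbits h)) = \<lceil>(real CARD('a) + 1) / real (rf_degree h)\<rceil> + 1)"
proof -
  interpret group_action "galois_group h" rational_places place_action
    by (rule group_action_places)
  have "card (invariants rational_places place_action \<sigma>) \<le> 2"
    if "\<sigma> \<in> carrier (galois_group h)" "\<sigma> \<noteq> \<one>\<^bsub>galois_group h\<^esub>" for \<sigma>
  proof -
    \<comment> \<open>The restriction in \<open>place_action\<close> is invisible here, since
      invariants are taken among the rational places.\<close>
    have "invariants rational_places place_action \<sigma> = {P \<in> rational_places. \<sigma> ` P = P}"
      by (auto simp: invariants_def place_action_def)
    then show ?thesis
      using card_fixed_rational_places_le[of \<sigma>] field_auts_over_adjoinD[of \<sigma> h] that
      by (simp add: galois_group_def)
  qed
  note count = orbit_count_two_fixed_points[OF order_galois_group(1)[OF assms]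
    card_rational_places(1) this, folded place_orbits_def, folded short_orbits_def,
    unfolded order_galois_group(2)[OF assms] card_rational_places(2)]
  then show ?thesis by (simp add: add.commute)
qed

end
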